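(* Assuming $\Diamond$, there exists an ultrafilter on the random algebra $\mathbb{B}_\omega$ which is not Tukey maximal.
   Context: $\Diamond$ is the principle: there exists a sequence $\langle S_\alpha : \alpha<\omega_1\rangle$ with $S_\alpha\subseteq\alpha$ such that for every $X\subseteq\omega_1$ the set $\{\alpha<\omega_1 : X\cap\alpha=S_\alpha\}$ is stationary. The random algebra $\mathbb{B}_\omega$ is the quotient $\mathcal{B}({}^\omega 2)/\mathcal{N}$ of the Borel $\sigma$-algebra of the Cantor space ${}^\omega 2$ by the ideal $\mathcal{N}$ of null sets for the standard product measure. For directed sets $\langle D,\le^D\rangle$, $\langle E,\le^E\rangle$, write $D\le_{\mathrm{T}}E$ if there are functions $f\colon D\to E$ and $g\colon E\to D$ such that for all $d\in D$, $e\in E$: $f(d)\le^E e\implies d\le^D g(e)$. An ultrafilter $U$ on a Boolean algebra $\mathbb{B}$ is regarded as the directed set $\langle U,\ge\rangle$ (reverse Boolean order), and $U$ is Tukey maximal if $\langle[\mathbb{B}]^{<\aleph_0},\subseteq\rangle\le_{\mathrm{T}}\langle U,\ge\rangle$, where $[\mathbb{B}]^{<\aleph_0}$ is the set of finite subsets of $\mathbb{B}$. *)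

theory Defs
  imports "HOL-Probability.Probability"
begin

text \<open>
  The ordinal \<open>\<omega>\<^sub>1\<close> is the well-order \<open>cardSuc natLeq\<close>, the least well-order of
  uncountable cardinality. Countable ordinals are the elements of its
  field, and an ordinal \<open>\<alpha>\<close>, as a set of ordinals, is \<open>underS \<omega>\<^sub>1 \<alpha>\<close>.
\<close>

abbreviation omega1 :: "nat set rel" ("\<omega>\<^sub>1")
  where "\<omega>\<^sub>1 \<equiv> cardSuc natLeq"

definition unbounded_in_omega1 :: "nat set set \<Rightarrow> bool" where
  "unbounded_in_omega1 C \<longleftrightarrow> (\<forall>\<beta>\<in>Field \<omega>\<^sub>1. \<exists>\<gamma>\<in>C. \<beta> \<in> underS \<omega>\<^sub>1 \<gamma>)"

text \<open>
  \<open>C\<close> contains all its limit points below \<open>\<omega>\<^sub>1\<close>. The requirement that every \<open>\<beta> < \<alpha>\<close> lies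
  strictly below some element of \<open>C \<inter> \<alpha>\<close> forces \<open>\<alpha>\<close> to be \<open>0\<close> or a limit; \<open>0\<close> is excluded.
\<close>

definition closed_in_omega1 :: "nat set set \<Rightarrow> bool" where
  "closed_in_omega1 C \<longleftrightarrow>
     (\<forall>\<alpha>\<in>Field \<omega>\<^sub>1. underS \<omega>\<^sub>1 \<alpha> \<noteq> {} \<and>
        (\<forall>\<beta>\<in>underS \<omega>\<^sub>1 \<alpha>. \<exists>\<gamma>\<in>C \<inter> underS \<omega>\<^sub>1 \<alpha>. \<beta> \<in> underS \<omega>\<^sub>1 \<gamma>) \<longrightarrow> \<alpha> \<in> C)"

definition club :: "nat set set \<Rightarrow> bool" where
  "club C \<longleftrightarrow> C \<subseteq> Field \<omega>\<^sub>1 \<and> unbounded_in_omega1 C \<and> closed_in_omega1 C"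

definition stationary :: "nat set set \<Rightarrow> bool" where
  "stationary T \<longleftrightarrow> T \<subseteq> Field \<omega>\<^sub>1 \<and> (\<forall>C. club C \<longrightarrow> T \<inter> C \<noteq> {})"

definition diamond :: bool ("\<diamond>") where
  "\<diamond> \<longleftrightarrow>
     (\<exists>S :: nat set \<Rightarrow> nat set set.
        (\<forall>\<alpha>\<in>Field \<omega>\<^sub>1. S \<alpha> \<subseteq> underS \<omega>\<^sub>1 \<alpha>) \<and>
        (\<forall>X\<subseteq>Field \<omega>\<^sub>1. stationary {\<alpha>\<in>Field \<omega>\<^sub>1. X \<inter> underS \<omega>\<^sub>1 \<alpha> = S \<alpha>}))"

text \<open>The Cantor space is \<^typ>\<open>nat \<Rightarrow> bool\<close> with its product topology.\<close>

definition cantor_measure :: "(nat \<Rightarrow> bool) measure" where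
  "cantor_measure = PiM UNIV (\<lambda>_. measure_pmf (bernoulli_pmf (1/2)))"

instance bool :: second_countable_topology
proof
  show "\<exists>B::bool set set. countable B \<and> open = generate_topology B"
    by (intro exI[of _ "range lessThan \<union> range greaterThan"] conjI countable_finite)
      (auto simp: open_bool_def)
qed

lemma sets_cantor_measure: "sets cantor_measure = sets borel"
proof -
  have *: "sets (measure_pmf p) = sets (borel :: bool measure)" for p :: "bool pmf"
  proof -
    have "B \<in> sets borel" for B :: "bool set" by (rule borel_open) (rule Topological_Spaces.open_discrete)
    then show ?thesis by auto
  qed
  have "sets cantor_measure = sets (PiM UNIV (\<lambda>_::nat. borel :: bool measure))"
    unfolding cantor_measure_def by (intro sets_PiM_cong refl *)
  then show ?thesis using sets_PiM_equal_borel by (rule trans)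
qed

definition eq_mod_null :: "(nat \<Rightarrow> bool) set \<Rightarrow> (nat \<Rightarrow> bool) set \<Rightarrow> bool" where
  "eq_mod_null A B \<longleftrightarrow>
     A \<in> sets borel \<and> B \<in> sets borel \<and> (A - B) \<union> (B - A) \<in> null_sets cantor_measure"

lemma null_subset:
  assumes "N \<in> null_sets cantor_measure" "A \<subseteq> N" "A \<in> sets borel"
  shows "A \<in> null_sets cantor_measure"
  using assms null_sets_subset sets_cantor_measure by blast

lemma null_Un:
  assumes "M \<in> null_sets cantor_measure" "N \<in> null_sets cantor_measure"
    "A \<subseteq> M \<union> N" "A \<in> sets borel"
  shows "A \<in> null_sets cantor_measure"
  using assms null_subset null_sets.Un by blast

lemma part_equivp_eq_mod_null: "part_equivp eq_mod_null"
proof (rule part_equivpI)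
  show "\<exists>A. eq_mod_null A A" by (intro exI[of _ "{}"]) (simp add: eq_mod_null_def)
  show "symp eq_mod_null" by (auto intro!: sympI simp: eq_mod_null_def Un_commute)
  show "transp eq_mod_null"
  proof (rule transpI)
    fix A B C assume "eq_mod_null A B" "eq_mod_null B C"
    then show "eq_mod_null A C"
      unfolding eq_mod_null_def
      by (auto intro: null_Un[of "(A - B) \<union> (B - A)" "(B - C) \<union> (C - B)"])
  qed
qed

quotient_type random_algebra = "(nat \<Rightarrow> bool) set" / partial: eq_mod_null
  by (rule part_equivp_eq_mod_null)

instantiation random_algebra :: boolean_algebra
begin

lift_definition bot_random_algebra :: random_algebra is "{}"
  by (simp add: eq_mod_null_def)

lift_definition top_random_algebra :: random_algebra is UNIV
  by (simp add: eq_mod_null_def)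

lift_definition inf_random_algebra :: "random_algebra \<Rightarrow> random_algebra \<Rightarrow> random_algebra"
  is "(\<inter>)"
  subgoal for A A' B B'
    unfolding eq_mod_null_def
    by (auto intro: null_Un[of "(A - A') \<union> (A' - A)" "(B - B') \<union> (B' - B)"])
  done

lift_definition sup_random_algebra :: "random_algebra \<Rightarrow> random_algebra \<Rightarrow> random_algebra"
  is "(\<union>)"
  subgoal for A A' B B'
    unfolding eq_mod_null_def
    by (auto intro: null_Un[of "(A - A') \<union> (A' - A)" "(B - B') \<union> (B' - B)"])
  done

lift_definition minus_random_algebra :: "random_algebra \<Rightarrow> random_algebra \<Rightarrow> random_algebra"
  is "(-)"
  subgoal for A A' B B'
    unfolding eq_mod_null_def
    by (auto intro: null_Un[of "(A - A') \<union> (A' - A)" "(B - B') \<union> (B' - B)"])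
  done

lift_definition uminus_random_algebra :: "random_algebra \<Rightarrow> random_algebra"
  is "uminus"
  subgoal for A A'
    unfolding eq_mod_null_def
    by (auto intro: null_subset[of "(A - A') \<union> (A' - A)"] borel_comp)
  done

lift_definition less_eq_random_algebra :: "random_algebra \<Rightarrow> random_algebra \<Rightarrow> bool"
  is "\<lambda>A B. A - B \<in> null_sets cantor_measure"
  subgoal for A A' B B'
  proof -
    assume 1: "eq_mod_null A A'" and 2: "eq_mod_null B B'"
    let ?M = "(A - A') \<union> (A' - A)" and ?N = "(B - B') \<union> (B' - B)"
    have N: "?M \<union> ?N \<in> null_sets cantor_measure"
      using 1 2 null_sets.Un unfolding eq_mod_null_def by blast
    have "A' - B' \<in> null_sets cantor_measure" if "A - B \<in> null_sets cantor_measure"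
      using 1 2 unfolding eq_mod_null_def by (intro null_Un[OF that N]) auto
    moreover have "A - B \<in> null_sets cantor_measure" if "A' - B' \<in> null_sets cantor_measure"
      using 1 2 unfolding eq_mod_null_def by (intro null_Un[OF that N]) auto
    ultimately show ?thesis by blast
  qed
  done

definition less_random_algebra :: "random_algebra \<Rightarrow> random_algebra \<Rightarrow> bool" where
  "less_random_algebra a b \<longleftrightarrow> a \<le> b \<and> \<not> b \<le> a"

instance
proof
  fix a b c :: random_algebra
  show "a < b \<longleftrightarrow> a \<le> b \<and> \<not> b \<le> a" by (rule less_random_algebra_def)
  show "a \<le> a" by transfer simp
  show "a \<le> c" if "a \<le> b" "b \<le> c"
    using that
    by transfer (rule null_Un, assumption, assumption, auto simp: eq_mod_null_def)
  show "a = b" if "a \<le> b" "b \<le> a"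
    using that by transfer (auto simp: eq_mod_null_def intro: null_sets.Un)
  show "inf a b \<le> a" by transfer (simp add: Diff_eq Int_ac)
  show "inf a b \<le> b" by transfer (simp add: Diff_eq Int_ac)
  show "a \<le> inf b c" if "a \<le> b" "a \<le> c"
    using that by transfer (simp add: Diff_Int null_sets.Un)
  show "a \<le> sup a b"
    by transfer (metis Diff_eq_empty_iff Un_upper1 null_sets.empty_sets)
  show "b \<le> sup a b"
    by transfer (metis Diff_eq_empty_iff Un_upper2 null_sets.empty_sets)
  show "sup b c \<le> a" if "b \<le> a" "c \<le> a"
    using that by transfer (simp add: Un_Diff null_sets.Un)
  show "bot \<le> a" by transfer simp
  show "a \<le> top" by transfer simp
  show "sup a (inf b c) = inf (sup a b) (sup a c)"
    by transfer (auto simp: eq_mod_null_def Un_Int_distrib)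
  show "inf a (- a) = bot" by transfer (simp add: eq_mod_null_def)
  show "sup a (- a) = top" by transfer (simp add: eq_mod_null_def)
  show "a - b = inf a (- b)" by transfer (auto simp: eq_mod_null_def Diff_eq)
qed

end

definition proper_filter :: "'a::boolean_algebra set \<Rightarrow> bool" where
  "proper_filter F \<longleftrightarrow>
     top \<in> F \<and> bot \<notin> F \<and> (\<forall>a\<in>F. \<forall>b\<in>F. inf a b \<in> F) \<and> (\<forall>a\<in>F. \<forall>b. a \<le> b \<longrightarrow> b \<in> F)"

definition ultrafilter :: "'a::boolean_algebra set \<Rightarrow> bool" where
  "ultrafilter U \<longleftrightarrow> proper_filter U \<and> (\<forall>F. proper_filter F \<and> U \<subseteq> F \<longrightarrow> F = U)"

lemma ultrafilter_iff:
  "ultrafilter U \<longleftrightarrow> proper_filter U \<and> (\<forall>a. a \<in> U \<or> - a \<in> U)"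
proof (intro iffI conjI allI)
  assume U: "ultrafilter U"
  then show pU: "proper_filter U" by (simp add: ultrafilter_def)
  fix a
  show "a \<in> U \<or> - a \<in> U"
  proof (rule disjCI)
    assume na: "- a \<notin> U"
    let ?F = "{b. \<exists>u\<in>U. inf u a \<le> b}"
    have "proper_filter ?F"
      unfolding proper_filter_def
    proof (intro conjI ballI allI impI)
      show "top \<in> ?F" using pU by (auto simp: proper_filter_def)
      show "bot \<notin> ?F"
      proof
        assume "bot \<in> ?F"
        then obtain u where "u \<in> U" "inf u a = bot" by (auto simp: bot_unique)
        then have "u \<le> - a" by (simp add: inf_shunt)
        with \<open>u \<in> U\<close> pU na show False by (auto simp: proper_filter_def)
      qed
    next
      fix b c assume "b \<in> ?F" "c \<in> ?F"
      then obtain u v where uv: "u \<in> U" "v \<in> U" and "inf u a \<le> b" "inf v a \<le> c" by blast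
      then have "inf (inf u v) a \<le> inf b c"
        by (meson inf.boundedI inf_le1 inf_le2 inf_mono order_refl order_trans)
      moreover have "inf u v \<in> U" using pU uv by (auto simp: proper_filter_def)
      ultimately show "inf b c \<in> ?F" by blast
    next
      fix b c assume "b \<in> ?F" "b \<le> c"
      then show "c \<in> ?F" using order_trans by blast
    qed
    moreover have "U \<subseteq> ?F" using inf_le1 by blast
    ultimately have "?F = U" using U by (auto simp: ultrafilter_def)
    moreover have "a \<in> ?F" using pU by (auto simp: proper_filter_def)
    ultimately show "a \<in> U" by blast
  qed
next
  assume U: "proper_filter U \<and> (\<forall>a. a \<in> U \<or> - a \<in> U)"
  show "ultrafilter U"
    unfolding ultrafilter_def
  proof (intro conjI allI impI)
    show "proper_filter U" using U by simp
    fix F assume F: "proper_filter F \<and> U \<subseteq> F"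
    have "a \<in> U" if "a \<in> F" for a
    proof (rule ccontr)
      assume "a \<notin> U"
      then have "- a \<in> F" using U F by blast
      then have "inf a (- a) \<in> F" using that F unfolding proper_filter_def by blast
      then show False using F by (simp add: proper_filter_def)
    qed
    then show "F = U" using F by blast
  qed
qed

definition tukey_le ::
  "'d set \<Rightarrow> ('d \<Rightarrow> 'd \<Rightarrow> bool) \<Rightarrow> 'e set \<Rightarrow> ('e \<Rightarrow> 'e \<Rightarrow> bool) \<Rightarrow> bool" where
  "tukey_le D leD E leE \<longleftrightarrow>
     (\<exists>f\<in>D \<rightarrow> E. \<exists>g\<in>E \<rightarrow> D. \<forall>d\<in>D. \<forall>e\<in>E. leE (f d) e \<longrightarrow> leD d (g e))"

definition tukey_maximal :: "'a::boolean_algebra set \<Rightarrow> bool" where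
  "tukey_maximal U \<longleftrightarrow> tukey_le {F :: 'a set. finite F} (\<subseteq>) U (\<ge>)"

end

theory Submission
  imports Defs "HOL-Library.Countable_Set_Type"
begin

text \<open>
  Only CH, a consequence of \<open>\<diamond>\<close>, is used. Under CH the sequences \<open>s\<close> of elements of the random
  algebra are well-ordered with countable initial segments, and \<open>U\<close> is the union of an increasing
  chain of countable sets \<open>G s\<close> with the finite intersection property, where \<open>G s\<close> decides every
  term of \<open>s\<close>. If all terms \<open>s n\<close> are accepted and the measure of \<open>s 0 - s n\<close> tends to \<open>0\<close>, then
  \<open>G s\<close> also contains a lower bound of infinitely many \<open>s n\<close>: a subsequence converging fast enough
  has a meet compatible with the countably many elements accepted so far. Since the measure algebra
  is separable, every uncountable subset of \<open>U\<close> contains such a sequence of distinct elements, so it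
  has an infinite subset bounded in \<open>U\<close>. A Tukey map from the finite subsets of the (uncountable)
  algebra, restricted to singletons, would produce an uncountable subset of \<open>U\<close> without one.
\<close>

section \<open>The measure algebra\<close>

interpretation cantor: prob_space cantor_measure
  unfolding cantor_measure_def by (intro prob_space_PiM prob_space_measure_pmf)

lift_definition rmeas :: "random_algebra \<Rightarrow> real" is "measure cantor_measure"
proof -
  fix A B :: "(nat \<Rightarrow> bool) set" assume AB: "eq_mod_null A B"
  then have "A - B \<in> null_sets cantor_measure" "B - A \<in> null_sets cantor_measure"
    unfolding eq_mod_null_def by (auto intro: null_subset[of "(A - B) \<union> (B - A)"])
  then have "AE x in cantor_measure. x \<in> A \<longleftrightarrow> x \<in> B"
    by (auto dest!: AE_not_in)
  then show "measure cantor_measure A = measure cantor_measure B"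
    using AB by (intro cantor.finite_measure_eq_AE) (auto simp: eq_mod_null_def sets_cantor_measure)
qed

lemma eq_mod_null_refl_iff: "eq_mod_null A A \<longleftrightarrow> A \<in> sets borel"
  by (simp add: eq_mod_null_def)

lemma random_algebra_rep:
  obtains A where "A \<in> sets borel" "abs_random_algebra A = a"
proof -
  obtain A where "eq_mod_null A A" "abs_random_algebra A = a"
    using Quotient3_random_algebra by (metis Quotient3_def)
  then show ?thesis using that by (simp add: eq_mod_null_refl_iff)
qed

lemma rmeas_nonneg [simp]: "0 \<le> rmeas a"
  by transfer simp

lemma rmeas_eq_0_iff [simp]: "rmeas a = 0 \<longleftrightarrow> a = bot"
proof (transfer, unfold eq_mod_null_def)
  fix A :: "(nat \<Rightarrow> bool) set"
  assume "A \<in> sets borel \<and> A \<in> sets borel \<and> A - A \<union> (A - A) \<in> null_sets cantor_measure"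
  then have "A \<in> sets cantor_measure" by (simp add: sets_cantor_measure)
  then have "measure cantor_measure A = 0 \<longleftrightarrow> A \<in> null_sets cantor_measure"
    by (simp add: cantor.emeasure_eq_measure null_sets_def)
  then show "measure cantor_measure A = 0 \<longleftrightarrow>
      A \<in> sets borel \<and> {} \<in> sets borel \<and> A - {} \<union> ({} - A) \<in> null_sets cantor_measure"
    using sets_cantor_measure by auto
qed

lemma rmeas_bot [simp]: "rmeas bot = 0"
  by simp

lemma rmeas_pos_iff: "0 < rmeas a \<longleftrightarrow> a \<noteq> bot"
  using rmeas_nonneg[of a] rmeas_eq_0_iff[of a] by linarith

lemma rmeas_split: "rmeas a = rmeas (inf a b) + rmeas (a - b)"
  by transfer
     (simp add: eq_mod_null_def cantor.finite_measure_Diff' sets_cantor_measure)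

lemma rmeas_mono: "a \<le> b \<Longrightarrow> rmeas a \<le> rmeas b"
  using rmeas_split[of b a] by (simp add: inf_absorb2)

lemma rmeas_sup_le: "rmeas (sup a b) \<le> rmeas a + rmeas b"
  by transfer (simp add: eq_mod_null_def measure_Un_le sets_cantor_measure)

section \<open>Separability: clopen sets are dense among the Borel sets\<close>

datatype bterm = Var nat | Neg bterm | Join bterm bterm

instance bterm :: countable
  by countable_datatype

text \<open>The values form the algebra generated by the coordinates, that is, the clopen sets.
  Indexing by terms makes this family visibly countable.\<close>

primrec clopen_of :: "bterm \<Rightarrow> (nat \<Rightarrow> bool) set" where
  "clopen_of (Var i) = {x. x i}"
| "clopen_of (Neg t) = - clopen_of t"
| "clopen_of (Join t u) = clopen_of t \<union> clopen_of u"

lemma space_cantor_measure [simp]: "space cantor_measure = UNIV"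
  by (simp add: cantor_measure_def space_PiM)

lemma cylinder_in_sets: "{x. x i \<in> B} \<in> sets cantor_measure"
proof -
  have "(\<lambda>x. x i) -` B \<inter> space cantor_measure \<in> sets cantor_measure"
    unfolding cantor_measure_def
    by (rule measurable_sets[OF measurable_component_singleton]) auto
  then show ?thesis by (simp add: vimage_def)
qed

lemma clopen_of_in_sets [simp]: "clopen_of t \<in> sets cantor_measure"
proof (induction t)
  case (Var i)
  show ?case using cylinder_in_sets[of i "{True}"] by simp
next
  case (Neg t)
  then show ?case using sets.compl_sets[of "clopen_of t" cantor_measure]
    by (simp add: Compl_eq_Diff_UNIV)
qed auto

lemma sym_diff_in_sets:
  "A \<in> sets M \<Longrightarrow> B \<in> sets M \<Longrightarrow> sym_diff A B \<in> sets M"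
  by (intro sets.Un sets.Diff)

abbreviation clopen_approx :: "(nat \<Rightarrow> bool) set \<Rightarrow> bool" where
  "clopen_approx A \<equiv>
     \<forall>\<epsilon>>0. \<exists>t. measure cantor_measure (sym_diff A (clopen_of t)) < \<epsilon>"

lemma clopen_approx_Un:
  assumes "A \<in> sets cantor_measure" "B \<in> sets cantor_measure"
    and "clopen_approx A" "clopen_approx B"
  shows "clopen_approx (A \<union> B)"
proof (intro allI impI)
  fix \<epsilon> :: real assume "\<epsilon> > 0"
  then obtain t u
    where t: "measure cantor_measure (sym_diff A (clopen_of t)) < \<epsilon> / 2"
      and u: "measure cantor_measure (sym_diff B (clopen_of u)) < \<epsilon> / 2"
    using assms(3,4) by (meson half_gt_zero)
  have "measure cantor_measure (sym_diff (A \<union> B) (clopen_of (Join t u)))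
    \<le> measure cantor_measure (sym_diff A (clopen_of t) \<union> sym_diff B (clopen_of u))"
    using assms(1,2) by (intro cantor.finite_measure_mono sets.Un[OF sym_diff_in_sets sym_diff_in_sets]) auto
  also have "\<dots> \<le> measure cantor_measure (sym_diff A (clopen_of t))
      + measure cantor_measure (sym_diff B (clopen_of u))"
    using assms(1,2) by (intro measure_Un_le sym_diff_in_sets sets.Diff) auto
  also have "\<dots> < \<epsilon>" using t u by simp
  finally show "\<exists>t. measure cantor_measure (sym_diff (A \<union> B) (clopen_of t)) < \<epsilon>" ..
qed

lemma clopen_approx_empty: "clopen_approx {}"
proof -
  have "sym_diff {} (clopen_of (Neg (Join (Var 0) (Neg (Var 0))))) = {}" by auto
  then show ?thesis by (metis measure_empty)
qed

text \<open>By continuity from below, a finite partial union misses at most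
  \<open>\<epsilon> / 2\<close> of the whole union; approximating it costs another
  \<open>\<epsilon> / 2\<close>.\<close>

lemma clopen_approx_countable_Union:
  fixes A :: "nat \<Rightarrow> (nat \<Rightarrow> bool) set"
  assumes A: "\<And>n. A n \<in> sets cantor_measure" and approx: "\<And>n. clopen_approx (A n)"
  shows "clopen_approx (\<Union>n. A n)"
proof (intro allI impI)
  fix \<epsilon> :: real assume \<epsilon>: "\<epsilon> > 0"
  define B where "B n = (\<Union>k<n. A k)" for n
  have B: "B n \<in> sets cantor_measure" for n using A by (auto simp: B_def)
  have apB: "clopen_approx (B n)" for n
  proof (induction n)
    case 0
    show ?case using clopen_approx_empty by (simp add: B_def)
  next
    case (Suc n)
    have "B (Suc n) = B n \<union> A n" by (auto simp: B_def lessThan_Suc)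
    then show ?case using clopen_approx_Un[OF B A Suc approx] by simp
  qed
  have "(\<lambda>n. measure cantor_measure (B n)) \<longlonglongrightarrow> measure cantor_measure (\<Union>n. B n)"
    using B by (intro cantor.finite_Lim_measure_incseq) (force simp: incseq_def B_def)+
  moreover have UB: "(\<Union>n. B n) = (\<Union>n. A n)" by (auto simp: B_def)
  ultimately obtain n
    where n: "\<bar>measure cantor_measure (B n) - measure cantor_measure (\<Union>n. A n)\<bar> < \<epsilon> / 2"
    using LIMSEQ_D[of _ _ "\<epsilon> / 2"] \<epsilon> by force
  have sub: "B n \<subseteq> (\<Union>n. A n)" using UB by auto
  have UA: "(\<Union>n. A n) \<in> sets cantor_measure" using A by auto
  have d: "measure cantor_measure ((\<Union>n. A n) - B n) < \<epsilon> / 2"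
    using n cantor.finite_measure_Diff[OF UA B sub] by linarith
  obtain t where t: "measure cantor_measure (sym_diff (B n) (clopen_of t)) < \<epsilon> / 2"
    using apB[of n] \<epsilon> by (meson half_gt_zero)
  have "measure cantor_measure (sym_diff (\<Union>n. A n) (clopen_of t))
    \<le> measure cantor_measure (((\<Union>n. A n) - B n) \<union> sym_diff (B n) (clopen_of t))"
    using UA B sub by (intro cantor.finite_measure_mono sets.Un[OF sets.Diff] sym_diff_in_sets) auto
  also have "\<dots> \<le> measure cantor_measure ((\<Union>n. A n) - B n)
      + measure cantor_measure (sym_diff (B n) (clopen_of t))"
    using UA B by (intro measure_Un_le sym_diff_in_sets sets.Diff) auto
  also have "\<dots> < \<epsilon>" using t d by simp
  finally show "\<exists>t. measure cantor_measure (sym_diff (\<Union>n. A n) (clopen_of t)) < \<epsilon>" ..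
qed

text \<open>Induction over the generation of the product sigma-algebra. A generator restricts one
  coordinate to a subset of \<open>bool\<close>, so it is itself clopen; complementation leaves
  symmetric differences unchanged.\<close>

lemma clopen_approx_measurable:
  assumes "A \<in> sets cantor_measure"
  shows "clopen_approx A"
proof -
  have "A \<in> sigma_sets UNIV {{x. x i \<in> B} | i B. True}"
    using assms unfolding cantor_measure_def sets_PiM_single by simp
  then show ?thesis
  proof induction
    case (Basic A)
    then obtain i B where AB: "A = {x. x i \<in> B}" by auto
    have "B = {} \<or> B = {True} \<or> B = {False} \<or> B = UNIV"
      unfolding UNIV_bool set_eq_iff by auto (metis (full_types))+
    then have "\<exists>t. A = clopen_of t"
    proof (elim disjE)
      assume "B = {}"
      then show ?thesis using AB by (intro exI[of _ "Neg (Join (Var 0) (Neg (Var 0)))"]) auto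
    next
      assume "B = UNIV"
      then show ?thesis using AB by (intro exI[of _ "Join (Var 0) (Neg (Var 0))"]) auto
    next
      assume "B = {True}"
      then show ?thesis using AB by (intro exI[of _ "Var i"]) auto
    next
      assume "B = {False}"
      then show ?thesis using AB by (intro exI[of _ "Neg (Var i)"]) auto
    qed
    then obtain t where "A = clopen_of t" ..
    then have "measure cantor_measure (sym_diff A (clopen_of t)) = 0" by simp
    then show ?case by (intro allI impI exI[of _ t]) simp
  next
    case Empty
    show ?case by (rule clopen_approx_empty)
  next
    case (Compl A)
    show ?case
    proof (intro allI impI)
      fix \<epsilon> :: real assume "\<epsilon> > 0"
      then obtain t where "measure cantor_measure (sym_diff A (clopen_of t)) < \<epsilon>"
        using Compl.IH by blast
      moreover have "sym_diff (UNIV - A) (clopen_of (Neg t)) = sym_diff A (clopen_of t)" by auto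
      ultimately show "\<exists>t. measure cantor_measure (sym_diff (UNIV - A) (clopen_of t)) < \<epsilon>"
        by metis
    qed
  next
    case (Union A)
    have "A n \<in> sets cantor_measure" for n
      using Union.hyps[of n] unfolding cantor_measure_def sets_PiM_single by simp
    then show ?case by (rule clopen_approx_countable_Union) (rule Union.IH)
  qed
qed

lemma rmeas_abs: "A \<in> sets borel \<Longrightarrow> rmeas (abs_random_algebra A) = measure cantor_measure A"
  by (simp add: rmeas.abs_eq eq_mod_null_refl_iff)

text \<open>Both one-sided differences are bounded because closeness is measured later by the
  asymmetric \<open>rmeas (a - b)\<close>, and passing through a clopen set in
  \<open>rmeas_diff_triangle\<close> needs one of each.\<close>

lemma random_algebra_separable:
  assumes "\<epsilon> > 0"
  shows "\<exists>t. rmeas (a - abs_random_algebra (clopen_of t)) < \<epsilon> \<and>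
             rmeas (abs_random_algebra (clopen_of t) - a) < \<epsilon>"
proof -
  obtain A where A: "A \<in> sets borel" "abs_random_algebra A = a" by (rule random_algebra_rep)
  then obtain t where t: "measure cantor_measure (sym_diff A (clopen_of t)) < \<epsilon>"
    using clopen_approx_measurable assms by (metis sets_cantor_measure)
  have C: "clopen_of t \<in> sets borel" using clopen_of_in_sets sets_cantor_measure by blast
  have eq: "a - abs_random_algebra (clopen_of t) = abs_random_algebra (A - clopen_of t)"
           "abs_random_algebra (clopen_of t) - a = abs_random_algebra (clopen_of t - A)"
    using A C by (auto simp: minus_random_algebra.abs_eq eq_mod_null_refl_iff)
  have "measure cantor_measure (A - clopen_of t) \<le> measure cantor_measure (sym_diff A (clopen_of t))"
    "measure cantor_measure (clopen_of t - A) \<le> measure cantor_measure (sym_diff A (clopen_of t))"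
    using A by (auto intro!: cantor.finite_measure_mono sym_diff_in_sets simp: sets_cantor_measure[symmetric])
  then show ?thesis using t A C by (intro exI[of _ t]) (auto simp: eq rmeas_abs)
qed

text \<open>The meet is the class of an intersection of representatives. The second property is
  continuity of the measure from above, relative to an arbitrary \<open>b\<close>.\<close>

lemma random_algebra_decreasing_meet:
  fixes P :: "nat \<Rightarrow> random_algebra"
  assumes dec: "\<And>n. P (Suc n) \<le> P n"
  obtains w where "\<And>n. w \<le> P n"
    and "\<And>b \<epsilon>. (\<And>n. \<epsilon> \<le> rmeas (inf (P n) b)) \<Longrightarrow> \<epsilon> \<le> rmeas (inf w b)"
proof -
  have "\<exists>A. A \<in> sets borel \<and> abs_random_algebra A = P n" for n by (metis random_algebra_rep)
  then obtain A where A: "A n \<in> sets borel" "abs_random_algebra (A n) = P n" for n by metis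
  \<comment> \<open>The representatives \<open>A n\<close> decrease only modulo null sets; their
    finite intersections decrease as sets and represent the same classes.\<close>
  define B where "B n = (\<Inter>k\<le>n. A k)" for n
  have B: "B n \<in> sets borel" for n using A by (auto simp: B_def)
  have absB: "abs_random_algebra (B n) = P n" for n
  proof (induction n)
    case (Suc n)
    have "B (Suc n) = B n \<inter> A (Suc n)" by (auto simp: B_def le_Suc_eq)
    then have "abs_random_algebra (B (Suc n)) = inf (P n) (P (Suc n))"
      using A B Suc by (metis inf_random_algebra.abs_eq eq_mod_null_refl_iff)
    then show ?case using dec by (simp add: inf_absorb2)
  qed (simp add: B_def A)
  define W where "W = (\<Inter>n. B n)"
  have W: "W \<in> sets borel" using B by (auto simp: W_def)
  show ?thesis
  proof (rule that)
    show "abs_random_algebra W \<le> P n" for n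
    proof -
      have "W - B n = {}" by (auto simp: W_def)
      then have "W - B n \<in> null_sets cantor_measure" by (metis null_sets.empty_sets)
      then have "abs_random_algebra W \<le> abs_random_algebra (B n)"
        using W B by (simp add: less_eq_random_algebra.abs_eq eq_mod_null_refl_iff)
      then show ?thesis by (simp add: absB)
    qed
  next
    fix b \<epsilon> assume ge: "\<And>n. \<epsilon> \<le> rmeas (inf (P n) b)"
    obtain C where C: "C \<in> sets borel" "abs_random_algebra C = b" by (rule random_algebra_rep)
    have meas: "rmeas (inf (abs_random_algebra X) b) = measure cantor_measure (X \<inter> C)"
      if "X \<in> sets borel" for X
    proof -
      have "inf (abs_random_algebra X) b = abs_random_algebra (X \<inter> C)"
        using that C by (simp add: inf_random_algebra.abs_eq[symmetric] eq_mod_null_refl_iff)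
      then show ?thesis using that C by (simp add: rmeas_abs)
    qed
    have "(\<lambda>n. measure cantor_measure (B n \<inter> C)) \<longlonglongrightarrow> measure cantor_measure (\<Inter>n. B n \<inter> C)"
    proof (rule cantor.finite_Lim_measure_decseq)
      show "range (\<lambda>n. B n \<inter> C) \<subseteq> sets cantor_measure"
        using B C by (auto simp: sets_cantor_measure)
      have "B n \<subseteq> B m" if "m \<le> n" for m n
        unfolding B_def using that by (intro INF_superset_mono) auto
      then show "decseq (\<lambda>n. B n \<inter> C)" unfolding decseq_def by blast
    qed
    moreover have "\<epsilon> \<le> measure cantor_measure (B n \<inter> C)" for n
      using ge[of n] meas[OF B] by (simp add: absB)
    ultimately have "\<epsilon> \<le> measure cantor_measure (\<Inter>n. B n \<inter> C)"
      using LIMSEQ_le_const by blast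
    also have "(\<Inter>n. B n \<inter> C) = W \<inter> C" by (auto simp: W_def)
    finally show "\<epsilon> \<le> rmeas (inf (abs_random_algebra W) b)" using meas[OF W] by simp
  qed
qed

text \<open>Infinitely many disjoint sets of positive measure embed the power set of the naturals:
  distinct index sets have unions differing by a set of positive measure.\<close>

lemma uncountable_random_algebra: "uncountable (UNIV :: random_algebra set)"
proof -
  \<comment> \<open>\<open>Q n\<close> consists of the points whose first \<open>True\<close> is at
    \<open>n\<close>.\<close>
  define Q :: "nat \<Rightarrow> (nat \<Rightarrow> bool) set" where "Q n = {x. x n \<and> (\<forall>i<n. \<not> x i)}" for n
  \<comment> \<open>As a box over the coordinates up to \<open>n\<close>, \<open>Q n\<close> has a
    finite product as its measure. The side \<open>{i = n}\<close> is \<open>{True}\<close> at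
    \<open>i = n\<close> and \<open>{False}\<close> at smaller \<open>i\<close>.\<close>
  have Qemb: "Q n = prod_emb UNIV (\<lambda>_. measure_pmf (bernoulli_pmf (1/2))) {..n} (Pi\<^sub>E {..n} (\<lambda>i. {i = n}))" for n
  proof (rule set_eqI)
    fix x :: "nat \<Rightarrow> bool"
    have "x \<in> Q n \<longleftrightarrow> (\<forall>i\<le>n. x i \<longleftrightarrow> i = n)"
      unfolding Q_def mem_Collect_eq by (metis le_less less_irrefl order_refl)
    also have "\<dots> \<longleftrightarrow> x \<in> prod_emb UNIV (\<lambda>_. measure_pmf (bernoulli_pmf (1/2))) {..n}
        (Pi\<^sub>E {..n} (\<lambda>i. {i = n}))"
      by (auto simp: prod_emb_def restrict_PiE_iff Pi_iff)
    finally show "x \<in> Q n \<longleftrightarrow> x \<in> prod_emb UNIV (\<lambda>_. measure_pmf (bernoulli_pmf (1/2))) {..n}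
        (Pi\<^sub>E {..n} (\<lambda>i. {i = n}))" .
  qed
  have pos: "measure cantor_measure (Q n) > 0" for n
  proof -
    have "emeasure cantor_measure (Q n) =
        (\<Prod>i\<le>n. emeasure (measure_pmf (bernoulli_pmf (1/2))) {i = n})"
      unfolding Qemb cantor_measure_def
      by (intro emeasure_PiM_emb prob_space_measure_pmf) auto
    moreover have "emeasure (measure_pmf (bernoulli_pmf (1/2))) {b} \<noteq> 0" for b
      by (cases b) (auto simp: emeasure_pmf_single)
    ultimately have "emeasure cantor_measure (Q n) \<noteq> 0"
      by simp
    then show ?thesis by (simp add: cantor.emeasure_eq_measure zero_less_measure_iff)
  qed
  have Qs: "Q n \<in> sets cantor_measure" for n
    unfolding Qemb cantor_measure_def by (rule sets_PiM_I) auto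
  define E where "E N = (\<Union>n\<in>N. Q n)" for N :: "nat set"
  have Es: "E N \<in> sets borel" for N
    using Qs by (auto simp: E_def sets_cantor_measure[symmetric])
  have "inj (\<lambda>N. abs_random_algebra (E N))"
  proof (rule injI)
    have sub: "N \<subseteq> M" if eq: "abs_random_algebra (E N) = abs_random_algebra (E M)" for N M
    proof
      fix n assume "n \<in> N"
      show "n \<in> M"
      proof (rule ccontr)
        assume "n \<notin> M"
        have disj: "m = n" if "x \<in> Q n" "x \<in> Q m" for x m
          using that unfolding Q_def mem_Collect_eq by (metis linorder_neqE_nat)
        have "abs_random_algebra (E N) \<le> abs_random_algebra (E M)" using eq by simp
        then have "E N - E M \<in> null_sets cantor_measure"
          using Es by (simp add: less_eq_random_algebra.abs_eq eq_mod_null_refl_iff)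
        moreover have "Q n \<subseteq> E N - E M"
        proof
          fix x assume x: "x \<in> Q n"
          then have "x \<notin> E M" using disj \<open>n \<notin> M\<close> unfolding E_def by blast
          then show "x \<in> E N - E M" using x \<open>n \<in> N\<close> by (auto simp: E_def)
        qed
        ultimately have "Q n \<in> null_sets cantor_measure"
          using null_sets_subset Qs by blast
        then show False using pos[of n] by (simp add: measure_eq_0_null_sets)
      qed
    qed
    show "N = M" if "abs_random_algebra (E N) = abs_random_algebra (E M)" for N M
      using sub[OF that] sub[OF that[symmetric]] by blast
  qed
  moreover have "uncountable (UNIV :: nat set set)"
    using Cantors_theorem[of "UNIV :: nat set"] by (simp add: uncountable_def)
  ultimately have "uncountable (range (\<lambda>N. abs_random_algebra (E N)))"
    using countable_image_inj_on by blast
  then show ?thesis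
    using countable_subset subset_UNIV by blast
qed

section \<open>Construction of the ultrafilter\<close>

text \<open>This is the finite intersection property, phrased with a nonzero lower bound so that no
  meet over a finite set has to be formed. For empty \<open>F\<close> it says that the algebra is
  nontrivial.\<close>

definition fip :: "'a::boolean_algebra set \<Rightarrow> bool" where
  "fip Z \<longleftrightarrow> (\<forall>F. finite F \<longrightarrow> F \<subseteq> Z \<longrightarrow> (\<exists>x. x \<noteq> bot \<and> (\<forall>a\<in>F. x \<le> a)))"

lemma fip_subset: "fip Z \<Longrightarrow> Y \<subseteq> Z \<Longrightarrow> fip Y"
  unfolding fip_def by (blast dest: subset_trans)

lemma fipD: "fip Z \<Longrightarrow> finite F \<Longrightarrow> F \<subseteq> Z \<Longrightarrow> \<exists>x. x \<noteq> bot \<and> (\<forall>a\<in>F. x \<le> a)"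
  unfolding fip_def by blast

lemma not_fipE:
  assumes "\<not> fip Z"
  obtains F where "finite F" "F \<subseteq> Z" "\<And>x. \<forall>a\<in>F. x \<le> a \<Longrightarrow> x = bot"
proof -
  have "\<exists>F. finite F \<and> F \<subseteq> Z \<and> (\<forall>x. (\<forall>a\<in>F. x \<le> a) \<longrightarrow> x = bot)"
    using assms unfolding fip_def by (metis (no_types, lifting))
  then show ?thesis using that by auto
qed

text \<open>If both extensions failed, the two finite witnesses without \<open>a\<close> and
  \<open>- a\<close> would have a common nonzero lower bound \<open>x\<close> in \<open>Z\<close>'s
  sense; but \<open>x\<close> would be disjoint from both \<open>a\<close> and
  \<open>- a\<close>.\<close>

lemma fip_insert_or_insert_compl:
  fixes a :: "'a::boolean_algebra"
  assumes "fip Z"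
  shows "fip (insert a Z) \<or> fip (insert (- a) Z)"
proof (rule ccontr)
  assume "\<not> ?thesis"
  then have neg: "\<not> fip (insert a Z)" "\<not> fip (insert (- a) Z)" by auto
  obtain F where F: "finite F" "F \<subseteq> insert a Z" "\<And>x. \<forall>c\<in>F. x \<le> c \<Longrightarrow> x = bot"
    by (rule not_fipE[OF neg(1)]) (rule that)
  obtain G where G: "finite G" "G \<subseteq> insert (- a) Z" "\<And>x. \<forall>c\<in>G. x \<le> c \<Longrightarrow> x = bot"
    by (rule not_fipE[OF neg(2)]) (rule that)
  have FG: "finite (F - {a} \<union> (G - {- a}))" "F - {a} \<union> (G - {- a}) \<subseteq> Z"
    using F G by auto
  then obtain x where x: "x \<noteq> bot" "\<forall>c\<in>F - {a} \<union> (G - {- a}). x \<le> c"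
    using fipD[OF assms FG] by (elim exE conjE)
  have "\<forall>c\<in>F. inf x a \<le> c"
  proof
    show "inf x a \<le> c" if "c \<in> F" for c
      using x(2) that by (cases "c = a") (auto intro: le_infI1)
  qed
  then have "inf x a = bot" by (rule F(3))
  moreover have "\<forall>c\<in>G. inf x (- a) \<le> c"
  proof
    show "inf x (- a) \<le> c" if "c \<in> G" for c
      using x(2) that by (cases "c = - a") (auto intro: le_infI1)
  qed
  then have "inf x (- a) = bot" by (rule G(3))
  ultimately have "inf x (sup a (- a)) = bot" by (simp only: inf_sup_distrib1) simp
  then show False using x(1) by simp
qed

lemma fip_Union_chain:
  assumes "\<And>Z. Z \<in> \<C> \<Longrightarrow> fip Z" "subset.chain UNIV \<C>" "\<C> \<noteq> {}"
  shows "fip (\<Union>\<C>)"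
  unfolding fip_def
proof (intro allI impI)
  fix F assume "finite F" "F \<subseteq> \<Union>\<C>"
  then obtain Z where "Z \<in> \<C>" "F \<subseteq> Z"
    using finite_subset_Union_chain assms(2,3) by metis
  then show "\<exists>x. x \<noteq> bot \<and> (\<forall>a\<in>F. x \<le> a)"
    using fipD[OF assms(1)] \<open>finite F\<close> by blast
qed

text \<open>Since \<open>U\<close> decides every element, a failure of closure under meets or of
  upward closure would put elements with meet \<open>bot\<close> into \<open>U\<close>, against
  \<open>fip\<close>.\<close>

lemma ultrafilter_if_fip:
  assumes fip: "fip U" and dec: "\<And>a. a \<in> U \<or> - a \<in> U"
  shows "ultrafilter U"
proof -
  have 2: False if "c \<in> U" "a \<in> U" "b \<in> U" "inf (inf a b) c = bot" for a b c
  proof -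
    obtain x where "x \<noteq> bot" "\<forall>y\<in>{a, b, c}. x \<le> y"
      using fipD[OF fip, of "{a, b, c}"] \<open>c \<in> U\<close> \<open>a \<in> U\<close> \<open>b \<in> U\<close> by auto
    then have "x \<le> inf (inf a b) c" by simp
    then show False using \<open>x \<noteq> bot\<close> that(4) by (simp add: bot_unique)
  qed
  have bot: "bot \<notin> U" using 2[of bot bot bot] by auto
  show ?thesis
    unfolding ultrafilter_iff proper_filter_def
  proof (intro conjI ballI allI impI dec bot)
    show "top \<in> U" using dec[of top] bot by simp
    show "inf a b \<in> U" if "a \<in> U" "b \<in> U" for a b
      using dec[of "inf a b"] 2[of "- inf a b" a b] that by (metis inf_compl_bot)
    show "b \<in> U" if "a \<in> U" "a \<le> b" for a b
    proof (rule ccontr)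
      assume "b \<notin> U"
      then have "- b \<in> U" using dec by blast
      moreover have "inf (inf a a) (- b) = bot" using that by (simp add: inf_shunt)
      ultimately show False using 2 that by blast
    qed
  qed
qed

text \<open>Zorn's lemma gives a maximal \<open>fip\<close> family; by
  \<open>fip_insert_or_insert_compl\<close> maximality makes it decide every element.\<close>

lemma fip_extend_ultrafilter:
  assumes "fip Z"
  obtains U where "ultrafilter U" "Z \<subseteq> U"
proof -
  have "\<exists>U\<in>{V. fip V \<and> Z \<subseteq> V}. \<forall>V\<in>{V. fip V \<and> Z \<subseteq> V}. U \<subseteq> V \<longrightarrow> V = U"
  proof (rule subset_Zorn_nonempty)
    show "{V. fip V \<and> Z \<subseteq> V} \<noteq> {}" using assms by blast
    fix \<C> assume \<C>: "\<C> \<noteq> {}" "subset.chain {V. fip V \<and> Z \<subseteq> V} \<C>"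
    then have "fip (\<Union>\<C>)" by (intro fip_Union_chain) (auto simp: subset_chain_def)
    then show "\<Union>\<C> \<in> {V. fip V \<and> Z \<subseteq> V}" using \<C> by (fastforce simp: subset_chain_def)
  qed
  then obtain U where U: "fip U" "Z \<subseteq> U"
    and max: "\<And>V. fip V \<Longrightarrow> U \<subseteq> V \<Longrightarrow> V = U" by fastforce
  have "a \<in> U \<or> - a \<in> U" for a
    using fip_insert_or_insert_compl[OF U(1), of a] max[of "insert a U"] max[of "insert (- a) U"]
    by blast
  then show ?thesis using that ultrafilter_if_fip U by blast
qed

lemma proper_filterD:
  assumes "proper_filter V"
  shows "top \<in> V" "bot \<notin> V" "a \<in> V \<Longrightarrow> b \<in> V \<Longrightarrow> inf a b \<in> V" "a \<in> V \<Longrightarrow> a \<le> b \<Longrightarrow> b \<in> V"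
  using assms unfolding proper_filter_def by blast+

lemma proper_filter_imp_fip:
  assumes "proper_filter V"
  shows "fip V"
  unfolding fip_def
proof (intro allI impI)
  fix F assume "finite F" "F \<subseteq> V"
  then have "\<exists>x\<in>V. \<forall>a\<in>F. x \<le> a"
  proof induction
    case empty
    show ?case using proper_filterD(1)[OF assms] by blast
  next
    case (insert a F)
    then obtain x where "x \<in> V" "\<forall>c\<in>F. x \<le> c" by auto
    then show ?case using insert.prems proper_filterD(3)[OF assms, of x a]
      by (intro bexI[of _ "inf x a"]) (auto intro: le_infI1)
  qed
  then show "\<exists>x. x \<noteq> bot \<and> (\<forall>a\<in>F. x \<le> a)" using proper_filterD(2)[OF assms] by metis
qed

text \<open>Meeting with \<open>t\<close> removes from \<open>inf P b\<close> only a part of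
  \<open>a - t\<close>. The loss is thus bounded independently of \<open>P\<close> and
  \<open>b\<close>, which allows control against all \<open>b n\<close> at once.\<close>

lemma rmeas_inf_ge:
  assumes "P \<le> a"
  shows "rmeas (inf P b) - rmeas (a - t) \<le> rmeas (inf (inf P t) b)"
proof -
  have "rmeas (inf P b) = rmeas (inf (inf P b) t) + rmeas (inf P b - t)" by (rule rmeas_split)
  moreover have "inf (inf P b) t = inf (inf P t) b" by (simp add: inf_commute inf_left_commute)
  moreover have "inf P b - t \<le> a - t"
    using assms by (simp add: diff_eq) (meson inf_le1 inf_mono le_infI1 order_refl order_trans)
  then have "rmeas (inf P b - t) \<le> rmeas (a - t)" by (rule rmeas_mono)
  ultimately show ?thesis by simp
qed

lemma rmeas_diff_triangle: "rmeas (a - c) \<le> rmeas (a - b) + rmeas (b - c)"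
proof -
  have "a - c = sup (inf (a - c) b) (inf (a - c) (- b))"
    by (simp flip: inf_sup_distrib1)
  also have "\<dots> \<le> sup (b - c) (a - b)"
    by (intro sup_mono) (auto simp: diff_eq intro: le_infI1 le_infI2)
  finally have "rmeas (a - c) \<le> rmeas (sup (b - c) (a - b))" by (rule rmeas_mono)
  also have "\<dots> \<le> rmeas (b - c) + rmeas (a - b)" by (rule rmeas_sup_le)
  finally show ?thesis by simp
qed

text \<open>The subsequence is chosen with each loss small compared with the measures of the meets
  reached so far. The limit \<open>w\<close> need not lie in \<open>V\<close>: being nonzero against
  every \<open>b n\<close> is enough to add it to a countable family cofinally met by the
  \<open>b n\<close>.\<close>

lemma compatible_lower_bound:
  fixes s b :: "nat \<Rightarrow> random_algebra"
  assumes V: "proper_filter V" and b: "\<And>n. b n \<in> V" and s: "\<And>n. s n \<in> V"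
    and lim: "(\<lambda>n. rmeas (s 0 - s n)) \<longlonglongrightarrow> 0"
  obtains w where "infinite {n. w \<le> s n}" "\<And>n. inf w (b n) \<noteq> bot"
proof -
  have pos: "0 < rmeas (inf p (b n))" if "p \<in> V" for p n
    using proper_filterD(2,3)[OF V] that b by (metis rmeas_pos_iff)
  \<comment> \<open>\<open>\<eta>\<close> bounds the loss allowed at the next step. As it halves at each step and starts below a
    quarter of the measure of \<open>inf p (b n)\<close>, the losses after step \<open>n\<close> keep half of that measure.\<close>
  define inv where "inv n = (\<lambda>(i :: nat, p, \<eta>). p \<in> V \<and> p \<le> s i \<and> p \<le> s 0 \<and> 0 < \<eta> \<and>
      \<eta> \<le> rmeas (inf p (b n)) / 4)" for n
  define step where "step = (\<lambda>(i :: nat, p, \<eta>) (i', p', \<eta>' :: real). i < i' \<and> p' = inf p (s i') \<and>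
      rmeas (s 0 - s i') \<le> \<eta> \<and> \<eta>' \<le> \<eta> / 2)"
  have "\<exists>f. \<forall>n. inv n (f n) \<and> step (f n) (f (Suc n))"
  proof (rule dependent_nat_choice)
    show "\<exists>x. inv 0 x"
      using s[of 0] pos[OF s, of 0 0]
      by (intro exI[of _ "(0, s 0, rmeas (inf (s 0) (b 0)) / 4)"]) (auto simp: inv_def)
  next
    fix x n assume "inv n x"
    then obtain i p \<eta> where x: "x = (i, p, \<eta>)" "p \<in> V" "p \<le> s 0" "0 < \<eta>"
      by (auto simp: inv_def)
    have "\<forall>\<^sub>F n in sequentially. rmeas (s 0 - s n) < \<eta>"
      using order_tendstoD(2)[OF lim] x(4) by simp
    then have "\<forall>\<^sub>F n in sequentially. rmeas (s 0 - s n) < \<eta> \<and> i < n"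
      using eventually_gt_at_top by (rule eventually_conj)
    then obtain i' where i': "rmeas (s 0 - s i') < \<eta>" "i < i'"
      using eventually_happens trivial_limit_sequentially by blast
    have "inf p (s i') \<in> V" using x s proper_filterD(3)[OF V] by blast
    then show "\<exists>y. inv (Suc n) y \<and> step x y"
      using i' x pos[of "inf p (s i')" "Suc n"]
      by (intro exI[of _ "(i', inf p (s i'), min (\<eta> / 2) (rmeas (inf (inf p (s i')) (b (Suc n))) / 4))"])
        (auto simp: inv_def step_def intro: le_infI1)
  qed
  then obtain f where f: "\<And>n. inv n (f n)" "\<And>n. step (f n) (f (Suc n))" by blast
  define i p \<eta> where "i n = fst (f n)" and "p n = fst (snd (f n))" and "\<eta> n = snd (snd (f n))" for n
  have p: "p n \<in> V" "p n \<le> s (i n)" "p n \<le> s 0" "0 < \<eta> n" "\<eta> n \<le> rmeas (inf (p n) (b n)) / 4" for n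
    using f(1)[of n] by (auto simp: inv_def i_def p_def \<eta>_def split: prod.splits)
  have step: "i n < i (Suc n)" "p (Suc n) = inf (p n) (s (i (Suc n)))"
    "rmeas (s 0 - s (i (Suc n))) \<le> \<eta> n" "\<eta> (Suc n) \<le> \<eta> n / 2" for n
    using f(2)[of n] by (auto simp: step_def i_def p_def \<eta>_def split: prod.splits)
  have p_Suc: "p (Suc n) \<le> p n" for n by (simp add: step(2))
  obtain w where w: "\<And>n. w \<le> p n"
    "\<And>c \<epsilon>. (\<And>n. \<epsilon> \<le> rmeas (inf (p n) c)) \<Longrightarrow> \<epsilon> \<le> rmeas (inf w c)"
    using random_algebra_decreasing_meet[of p] p_Suc by metis
  show ?thesis
  proof (rule that)
    have "strict_mono i" using step(1) by (simp add: strict_mono_Suc_iff)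
    then have "infinite (range i)" using range_inj_infinite strict_mono_imp_inj_on by blast
    moreover have "range i \<subseteq> {n. w \<le> s n}" using w(1) p(2) order_trans by blast
    ultimately show "infinite {n. w \<le> s n}" using finite_subset by blast
  next
    fix k
    define \<delta> where "\<delta> = rmeas (inf (p k) (b k))"
    \<comment> \<open>The losses after stage \<open>j\<close> add up to at most
      \<open>2 * \<eta> j\<close> because the bounds halve. At \<open>j = k\<close> the inequality
      is exactly \<open>\<eta> k \<le> \<delta> / 4\<close>.\<close>
    have ge: "\<delta> / 2 + 2 * \<eta> j \<le> rmeas (inf (p j) (b k))" if "k \<le> j" for j
      using that
    proof (induction j rule: dec_induct)
      case base
      show ?case using p(5)[of k] unfolding \<delta>_def by linarith
    next
      case (step j)
      have "rmeas (inf (p j) (b k)) - rmeas (s 0 - s (i (Suc j))) \<le> rmeas (inf (p (Suc j)) (b k))"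
        unfolding \<open>\<And>n. p (Suc n) = inf (p n) (s (i (Suc n)))\<close> by (rule rmeas_inf_ge) (rule p)
      then show ?case
        using step.IH \<open>\<And>n. rmeas (s 0 - s (i (Suc n))) \<le> \<eta> n\<close>[of j]
          \<open>\<And>n. \<eta> (Suc n) \<le> \<eta> n / 2\<close>[of j] by linarith
    qed
    \<comment> \<open>Passing to \<open>w\<close> requires the bound at every index; before
      \<open>k\<close> it follows because \<open>p\<close> is decreasing.\<close>
    have "\<delta> / 2 \<le> rmeas (inf (p j) (b k))" for j
    proof (cases "k \<le> j")
      case True
      then show ?thesis using ge[of j] p(4)[of j] by linarith
    next
      case False
      then have "p k \<le> p j" using lift_Suc_antimono_le[of p j k] p_Suc by simp
      then have "\<delta> \<le> rmeas (inf (p j) (b k))"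
        unfolding \<delta>_def by (intro rmeas_mono inf_mono) auto
      then show ?thesis using rmeas_nonneg[of "inf (p k) (b k)"] unfolding \<delta>_def by linarith
    qed
    then have "\<delta> / 2 \<le> rmeas (inf w (b k))" by (rule w(2))
    moreover have "0 < \<delta>" unfolding \<delta>_def by (rule pos) (rule p)
    ultimately have "0 < rmeas (inf w (b k))" by linarith
    then show "inf w (b k) \<noteq> bot" by (simp add: rmeas_pos_iff)
  qed
qed

text \<open>The first clause makes the second persist: if a larger consistent family contains all
  terms of \<open>s\<close>, then \<open>Z\<close>, having decided them, contains them
  already.\<close>

definition settles :: "(nat \<Rightarrow> random_algebra) \<Rightarrow> random_algebra set \<Rightarrow> bool" where
  "settles s Z \<longleftrightarrow> (\<forall>n. s n \<in> Z \<or> - s n \<in> Z) \<and>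
     ((\<lambda>n. rmeas (s 0 - s n)) \<longlonglongrightarrow> 0 \<longrightarrow> range s \<subseteq> Z \<longrightarrow> (\<exists>w\<in>Z. infinite {n. w \<le> s n}))"

text \<open>An ultrafilter \<open>V\<close> above \<open>W\<close> supplies consistent decisions, of
  which only the countably many about \<open>s\<close> are kept. If all terms are accepted and
  converge, a compatible lower bound is added.\<close>

lemma settling_extension:
  assumes "countable W" "fip W"
  shows "\<exists>Z. W \<subseteq> Z \<and> countable Z \<and> fip Z \<and> settles s Z"
proof -
  obtain V where V: "ultrafilter V" "W \<subseteq> V" using fip_extend_ultrafilter[OF \<open>fip W\<close>] .
  then have pV: "proper_filter V" and dV: "\<And>a. a \<in> V \<or> - a \<in> V" by (auto simp: ultrafilter_iff)
  define Z where "Z = W \<union> V \<inter> (range s \<union> range (\<lambda>n. - s n))"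
  have cZ: "countable Z" using assms(1) unfolding Z_def by auto
  have ZV: "Z \<subseteq> V" "W \<subseteq> Z" using V by (auto simp: Z_def)
  have dZ: "s n \<in> Z \<or> - s n \<in> Z" for n using dV[of "s n"] by (auto simp: Z_def)
  show ?thesis
  proof (cases "(\<lambda>n. rmeas (s 0 - s n)) \<longlonglongrightarrow> 0 \<and> range s \<subseteq> Z")
    case False
    then have "settles s Z" using dZ by (auto simp: settles_def)
    then show ?thesis using cZ ZV fip_subset[OF proper_filter_imp_fip[OF pV]] by blast
  next
    case True
    define a where "a = from_nat_into Z"
    have ra: "range a = Z" unfolding a_def using cZ dZ by (intro range_from_nat_into) auto
    \<comment> \<open>\<open>b n\<close> is the meet of the first \<open>n\<close> members of the
      enumeration, so every finite subset of \<open>Z\<close> has some \<open>b n\<close> as a lower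
      bound.\<close>
    define b where "b = rec_nat top (\<lambda>n c. inf c (a n))"
    have b_Suc: "b (Suc n) = inf (b n) (a n)" and b_0: "b 0 = top" for n by (simp_all add: b_def)
    have bV: "b n \<in> V" for n
    proof (induction n)
      case 0
      show ?case using proper_filterD(1)[OF pV] by (simp add: b_0)
    next
      case (Suc n)
      have "a n \<in> V" using ra ZV by blast
      with Suc show ?case unfolding b_Suc by (rule proper_filterD(3)[OF pV])
    qed
    have b_le: "b n \<le> a k" if "k < n" for n k
    proof -
      have "b n \<le> b (Suc k)" using that lift_Suc_antimono_le[of b "Suc k" n] by (simp add: b_Suc)
      then show ?thesis by (simp add: b_Suc)
    qed
    have sV: "s n \<in> V" for n using True ZV by blast
    obtain w where w: "infinite {n. w \<le> s n}" "\<And>n. inf w (b n) \<noteq> bot"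
      by (rule compatible_lower_bound[of V b s]) (use pV bV sV True in auto)
    have "fip (insert w Z)"
      unfolding fip_def
    proof (intro allI impI)
      fix F assume F: "finite F" "F \<subseteq> insert w Z"
      then have "finite (F - {w})" "F - {w} \<subseteq> range a" using ra by auto
      then obtain K where K: "finite K" "F - {w} = a ` K" by (meson finite_subset_image)
      obtain n where n: "\<And>k. k \<in> K \<Longrightarrow> k < n" using finite_nat_bounded[OF K(1)] by auto
      have "inf w (b n) \<le> c" if "c \<in> F" for c
      proof (cases "c = w")
        case False
        then have "c \<in> a ` K" using that unfolding K(2)[symmetric] by simp
        then obtain k where "k \<in> K" "c = a k" by (rule imageE)
        then show ?thesis using b_le[OF n] by (simp add: le_infI2)
      qed simp
      then show "\<exists>x. x \<noteq> bot \<and> (\<forall>c\<in>F. x \<le> c)" using w(2)[of n] by blast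
    qed
    moreover have "settles s (insert w Z)" using dZ w(1) by (auto simp: settles_def)
    ultimately show ?thesis using cZ ZV by (intro exI[of _ "insert w Z"]) auto
  qed
qed

section \<open>Transfinite recursion over all sequences\<close>

lemma random_algebra_nontrivial: "(bot :: random_algebra) \<noteq> top"
proof
  assume "(bot :: random_algebra) = top"
  then have "a = bot" for a :: random_algebra 
    using top_greatest[of a] by (metis bot.extremum_uniqueI)
  then have "UNIV = {bot :: random_algebra}" by blast
  then show False using uncountable_random_algebra by (metis countable_empty countable_insert)
qed

text \<open>Recursion along \<open>r\<close> with choice. The sets built before \<open>s\<close>
  form a chain with countable union, because \<open>s\<close> has countably many predecessors, so
  \<open>settling_extension\<close> applies to that union.\<close>

lemma settling_chain:
  fixes r :: "(nat \<Rightarrow> random_algebra) rel"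
  assumes wf: "wf r" and tr: "trans r" and tot: "total r" and cnt: "\<And>s. countable {t. (t, s) \<in> r}"
  shows "\<exists>G. \<forall>s. (\<Union>t\<in>{t. (t, s) \<in> r}. G t) \<subseteq> G s \<and> countable (G s) \<and> fip (G s) \<and> settles s (G s)"
  using wf
proof (rule dependent_wf_choice)
  \<comment> \<open>The condition at \<open>s\<close> depends only on the values at predecessors of
    \<open>s\<close>, as the recursion principle demands.\<close>
  fix f g :: "(nat \<Rightarrow> random_algebra) \<Rightarrow> random_algebra set" and s Z
  assume "\<And>t. (t, s) \<in> r \<Longrightarrow> f t = g t"
  then have "(\<Union>t\<in>{t. (t, s) \<in> r}. f t) = (\<Union>t\<in>{t. (t, s) \<in> r}. g t)" by auto
  then show "((\<Union>t\<in>{t. (t, s) \<in> r}. f t) \<subseteq> Z \<and> countable Z \<and> fip Z \<and> settles s Z) =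
        ((\<Union>t\<in>{t. (t, s) \<in> r}. g t) \<subseteq> Z \<and> countable Z \<and> fip Z \<and> settles s Z)" by simp
next
  fix s and f :: "(nat \<Rightarrow> random_algebra) \<Rightarrow> random_algebra set"
  assume f: "\<And>t. (t, s) \<in> r \<Longrightarrow>
    (\<Union>u\<in>{u. (u, t) \<in> r}. f u) \<subseteq> f t \<and> countable (f t) \<and> fip (f t) \<and> settles t (f t)"
  \<comment> \<open>The empty set is inserted to keep the chain nonempty when \<open>s\<close> has
    no predecessor.\<close>
  let ?\<C> = "insert {} (f ` {t. (t, s) \<in> r})"
  have "fip (\<Union>?\<C>)"
  proof (rule fip_Union_chain)
    have "fip ({} :: random_algebra set)"
      unfolding fip_def using random_algebra_nontrivial by (auto intro!: exI[of _ top])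
    then show "fip Z" if "Z \<in> ?\<C>" for Z using f that by auto
    have "f t \<subseteq> f u \<or> f u \<subseteq> f t" if "(t, s) \<in> r" "(u, s) \<in> r" for t u
    proof (cases "t = u")
      case False
      then have "(t, u) \<in> r \<or> (u, t) \<in> r" using tot by (auto simp: total_on_def)
      then show ?thesis using f[OF that(1)] f[OF that(2)] by blast
    qed simp
    then show "subset.chain UNIV ?\<C>" unfolding subset_chain_def by auto
  qed simp
  moreover have "countable (\<Union>?\<C>)" using cnt f by auto
  ultimately obtain Z where "\<Union>?\<C> \<subseteq> Z" "countable Z" "fip Z" "settles s Z"
    using settling_extension by blast
  then show "\<exists>Z. (\<Union>t\<in>{t. (t, s) \<in> r}. f t) \<subseteq> Z \<and> countable Z \<and> fip Z \<and> settles s Z"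
    by (intro exI[of _ Z]) auto
qed

lemma settling_ultrafilter:
  fixes r :: "(nat \<Rightarrow> random_algebra) rel"
  assumes "wf r" "trans r" and tot: "total r" and "\<And>s. countable {t. (t, s) \<in> r}"
  obtains U where "ultrafilter U"
    "\<And>s. range s \<subseteq> U \<Longrightarrow> (\<lambda>n. rmeas (s 0 - s n)) \<longlonglongrightarrow> 0 \<Longrightarrow> \<exists>w\<in>U. infinite {n. w \<le> s n}"
proof -
  obtain G where G: "\<And>s. (\<Union>t\<in>{t. (t, s) \<in> r}. G t) \<subseteq> G s" "\<And>s. fip (G s)" "\<And>s. settles s (G s)"
    using settling_chain[OF assms] by metis
  let ?U = "\<Union>(range G)"
  have "fip ?U"
  proof (rule fip_Union_chain)
    have "G t \<subseteq> G u \<or> G u \<subseteq> G t" for t u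
    proof (cases "t = u")
      case False
      then have "(t, u) \<in> r \<or> (u, t) \<in> r" using tot by (auto simp: total_on_def)
      then show ?thesis using G(1) by blast
    qed simp
    then show "subset.chain UNIV (range G)" unfolding subset_chain_def by auto
  qed (use G in auto)
  \<comment> \<open>The constant sequence with value \<open>a\<close> is one of the sequences
    handled, so \<open>a\<close> is decided.\<close>
  moreover have "a \<in> ?U \<or> - a \<in> ?U" for a
    using G(3)[of "\<lambda>_. a"] by (auto simp: settles_def)
  ultimately have U: "ultrafilter ?U" by (rule ultrafilter_if_fip)
  then have pU: "proper_filter ?U" by (simp add: ultrafilter_iff)
  show ?thesis
  proof (rule that[OF U])
    fix s assume s: "range s \<subseteq> ?U" "(\<lambda>n. rmeas (s 0 - s n)) \<longlonglongrightarrow> 0"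
    \<comment> \<open>Stage \<open>s\<close> decided \<open>s n\<close>; rejection would put both
      \<open>s n\<close> and its complement into the filter.\<close>
    have "s n \<in> G s" for n
    proof (rule ccontr)
      assume "s n \<notin> G s"
      then have "- s n \<in> ?U" using G(3)[of s] by (auto simp: settles_def)
      moreover have "s n \<in> ?U" using s by blast
      ultimately have "inf (s n) (- s n) \<in> ?U" using proper_filterD(3)[OF pU] by blast
      then show False using proper_filterD(2)[OF pU] by simp
    qed
    then show "\<exists>w\<in>?U. infinite {n. w \<le> s n}"
      using G(3)[of s] s(2) by (auto simp: settles_def)
  qed
qed

text \<open>Otherwise each \<open>x\<close> has a radius \<open>e x\<close> with only finitely many
  elements of \<open>X\<close> near it. Sorting \<open>X\<close> by a precision \<open>k\<close> and
  a clopen approximation \<open>t\<close> yields countably many cells \<open>N k t\<close>; the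
  members of a cell lie within each other's radii, so each cell is finite.\<close>

lemma uncountable_has_accumulation_point:
  fixes X :: "random_algebra set"
  assumes "uncountable X"
  shows "\<exists>x\<in>X. \<forall>\<epsilon>>0. infinite {y\<in>X. rmeas (x - y) < \<epsilon>}"
proof (rule ccontr)
  assume "\<not> ?thesis"
  then have "\<forall>x\<in>X. \<exists>\<epsilon>. \<epsilon> > 0 \<and> finite {y\<in>X. rmeas (x - y) < \<epsilon>}" by auto
  from bchoice[OF this] obtain e
    where e: "\<And>x. x \<in> X \<Longrightarrow> e x > 0" "\<And>x. x \<in> X \<Longrightarrow> finite {y\<in>X. rmeas (x - y) < e x}"
    by auto
  define c where "c t = abs_random_algebra (clopen_of t)" for t
  define N where "N k t = {x\<in>X. 2 / real (Suc k) \<le> e x \<and> rmeas (x - c t) < 1 / real (Suc k) \<and>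
      rmeas (c t - x) < 1 / real (Suc k)}" for k t
  have fin: "finite (N k t)" for k t
  proof (cases "N k t = {}")
    case False
    then obtain x where x: "x \<in> N k t" by blast
    have "N k t \<subseteq> {y\<in>X. rmeas (x - y) < e x}"
    proof
      fix y assume y: "y \<in> N k t"
      have "rmeas (x - y) \<le> rmeas (x - c t) + rmeas (c t - y)" by (rule rmeas_diff_triangle)
      also have "\<dots> < e x" using x y by (simp add: N_def)
      finally show "y \<in> {y\<in>X. rmeas (x - y) < e x}" using y by (simp add: N_def)
    qed
    then show ?thesis using e(2)[of x] x by (auto simp: N_def intro: finite_subset)
  qed simp
  have "X \<subseteq> (\<Union>k t. N k t)"
  proof
    fix x assume x: "x \<in> X"
    obtain k where k: "1 / real (Suc k) < e x / 2"
      using reals_Archimedean[of "e x / 2"] e(1)[OF x] by (auto simp: inverse_eq_divide)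
    obtain t where "rmeas (x - c t) < 1 / real (Suc k)" "rmeas (c t - x) < 1 / real (Suc k)"
      using random_algebra_separable[of "1 / real (Suc k)" x] by (auto simp: c_def)
    then have "x \<in> N k t" using k x by (simp add: N_def)
    then show "x \<in> (\<Union>k t. N k t)" by blast
  qed
  moreover have "countable (\<Union>k t. N k t)"
    by (intro countable_UN countableI_type countable_finite fin)
  ultimately show False using assms countable_subset by blast
qed

section \<open>Diamond and the continuum hypothesis\<close>

lemma Card_order_omega1: "Card_order \<omega>\<^sub>1"
  by (simp add: cardSuc_Card_order natLeq_Card_order)

lemma wo_rel_omega1: "wo_rel \<omega>\<^sub>1"
  using Card_order_omega1 by (simp add: wo_rel_def card_order_on_well_order_on)

lemma trans_strict_omega1: "trans (\<omega>\<^sub>1 - Id)"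
  using wo_rel.TRANS[OF wo_rel_omega1] wo_rel.ANTISYM[OF wo_rel_omega1] by (rule trans_diff_Id)

lemma underS_omega1_mono: "\<beta> \<in> underS \<omega>\<^sub>1 \<alpha> \<Longrightarrow> underS \<omega>\<^sub>1 \<beta> \<subseteq> underS \<omega>\<^sub>1 \<alpha>"
proof
  fix \<gamma> assume "\<beta> \<in> underS \<omega>\<^sub>1 \<alpha>" "\<gamma> \<in> underS \<omega>\<^sub>1 \<beta>"
  then have "(\<gamma>, \<beta>) \<in> \<omega>\<^sub>1 - Id" "(\<beta>, \<alpha>) \<in> \<omega>\<^sub>1 - Id" by (simp_all add: underS_def)
  then have "(\<gamma>, \<alpha>) \<in> \<omega>\<^sub>1 - Id" by (rule transD[OF trans_strict_omega1])
  then show "\<gamma> \<in> underS \<omega>\<^sub>1 \<alpha>" by (simp add: underS_def)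
qed

lemma countable_underS_omega1:
  includes cardinal_syntax
  shows "countable (underS \<omega>\<^sub>1 \<alpha>)"
proof (cases "\<alpha> \<in> Field \<omega>\<^sub>1")
  case True
  from card_of_underS[OF Card_order_omega1 True] have "|underS \<omega>\<^sub>1 \<alpha>| <o \<omega>\<^sub>1" .
  then have "|underS \<omega>\<^sub>1 \<alpha>| \<le>o natLeq"
    by (simp add: cardSuc_ordLeq_ordLess[OF natLeq_Card_order card_of_Card_order])
  then show ?thesis by (simp add: countable_card_le_natLeq)
next
  case False
  then have "underS \<omega>\<^sub>1 \<alpha> = {}" by (auto simp: underS_def Field_def)
  then show ?thesis by simp
qed

lemma uncountable_Field_omega1:
  includes cardinal_syntax
  shows "uncountable (Field \<omega>\<^sub>1)"
proof
  assume "countable (Field \<omega>\<^sub>1)"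
  then have "|Field \<omega>\<^sub>1| \<le>o natLeq" by (simp add: countable_card_le_natLeq)
  moreover have "\<omega>\<^sub>1 =o |Field \<omega>\<^sub>1|"
    using card_of_Field_ordIso[OF Card_order_omega1] ordIso_symmetric by blast
  moreover have "natLeq <o \<omega>\<^sub>1" by (rule cardSuc_greater[OF natLeq_Card_order])
  ultimately show False
    by (meson not_ordLess_ordLeq ordIso_ordLeq_trans)
qed

text \<open>Countably many countable initial segments cannot cover an uncountable order; any point
  they miss lies above \<open>A\<close>.\<close>

lemma countable_bounded_omega1:
  assumes "countable A" "A \<subseteq> Field \<omega>\<^sub>1"
  obtains \<gamma> where "\<gamma> \<in> Field \<omega>\<^sub>1" "A \<subseteq> underS \<omega>\<^sub>1 \<gamma>"
proof -
  have "countable (\<Union>\<alpha>\<in>A. insert \<alpha> (underS \<omega>\<^sub>1 \<alpha>))"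
    using assms countable_underS_omega1 by auto
  then have "\<not> Field \<omega>\<^sub>1 \<subseteq> (\<Union>\<alpha>\<in>A. insert \<alpha> (underS \<omega>\<^sub>1 \<alpha>))"
    using uncountable_Field_omega1 by (metis countable_subset)
  then obtain \<gamma> where \<gamma>: "\<gamma> \<in> Field \<omega>\<^sub>1" "\<gamma> \<notin> (\<Union>\<alpha>\<in>A. insert \<alpha> (underS \<omega>\<^sub>1 \<alpha>))"
    unfolding subset_iff by auto
  have "\<alpha> \<in> underS \<omega>\<^sub>1 \<gamma>" if "\<alpha> \<in> A" for \<alpha>
  proof -
    have "\<alpha> \<noteq> \<gamma>" "\<alpha> \<in> Field \<omega>\<^sub>1" "(\<gamma>, \<alpha>) \<notin> \<omega>\<^sub>1"
      using \<gamma> that assms by (auto simp: underS_def)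
    then show ?thesis
      using \<gamma>(1) wo_rel.TOTALS[OF wo_rel_omega1] by (auto simp: underS_def)
  qed
  then show ?thesis using that \<gamma>(1) by blast
qed

text \<open>Final segments are the only clubs needed to derive CH from the diamond
  principle.\<close>

lemma club_above:
  assumes "\<gamma> \<in> Field \<omega>\<^sub>1"
  shows "club {\<alpha>\<in>Field \<omega>\<^sub>1. \<gamma> \<in> underS \<omega>\<^sub>1 \<alpha>}"
  unfolding club_def
proof (intro conjI)
  show "unbounded_in_omega1 {\<alpha>\<in>Field \<omega>\<^sub>1. \<gamma> \<in> underS \<omega>\<^sub>1 \<alpha>}"
    unfolding unbounded_in_omega1_def
  proof
    fix \<beta> assume "\<beta> \<in> Field \<omega>\<^sub>1"
    then obtain \<delta> where "\<delta> \<in> Field \<omega>\<^sub>1" "{\<beta>, \<gamma>} \<subseteq> underS \<omega>\<^sub>1 \<delta>"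
      using countable_bounded_omega1[of "{\<beta>, \<gamma>}"] assms by auto
    then show "\<exists>\<delta>\<in>{\<alpha>\<in>Field \<omega>\<^sub>1. \<gamma> \<in> underS \<omega>\<^sub>1 \<alpha>}. \<beta> \<in> underS \<omega>\<^sub>1 \<delta>" by blast
  qed
  show "closed_in_omega1 {\<alpha>\<in>Field \<omega>\<^sub>1. \<gamma> \<in> underS \<omega>\<^sub>1 \<alpha>}"
    unfolding closed_in_omega1_def
  proof (intro ballI impI, elim conjE)
    fix \<alpha> assume \<alpha>: "\<alpha> \<in> Field \<omega>\<^sub>1" "underS \<omega>\<^sub>1 \<alpha> \<noteq> {}"
      and lim: "\<forall>\<beta>\<in>underS \<omega>\<^sub>1 \<alpha>. \<exists>\<delta>\<in>{\<alpha>\<in>Field \<omega>\<^sub>1. \<gamma> \<in> underS \<omega>\<^sub>1 \<alpha>} \<inter> underS \<omega>\<^sub>1 \<alpha>. \<beta> \<in> underS \<omega>\<^sub>1 \<delta>"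
    then obtain \<delta> where "\<gamma> \<in> underS \<omega>\<^sub>1 \<delta>" "\<delta> \<in> underS \<omega>\<^sub>1 \<alpha>" by blast
    then have "\<gamma> \<in> underS \<omega>\<^sub>1 \<alpha>" using underS_omega1_mono by blast
    then show "\<alpha> \<in> {\<alpha>\<in>Field \<omega>\<^sub>1. \<gamma> \<in> underS \<omega>\<^sub>1 \<alpha>}" using \<alpha> by blast
  qed
qed auto

text \<open>A copy \<open>e\<close> of the naturals lies below some \<open>\<gamma>\<close>. For any
  \<open>A\<close>, stationarity gives an \<open>\<alpha>\<close> above \<open>\<gamma>\<close>
  where the diamond sequence guesses the image of \<open>A\<close> correctly, hence entirely.
  Pulling the guesses back along \<open>e\<close> therefore enumerates all sets of naturals.\<close>

lemma diamond_imp_CH: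
  assumes "\<diamond>"
  shows "\<exists>h. h ` Field \<omega>\<^sub>1 = (UNIV :: nat set set)"
proof -
  obtain S where S: "\<forall>X\<subseteq>Field \<omega>\<^sub>1. stationary {\<alpha>\<in>Field \<omega>\<^sub>1. X \<inter> underS \<omega>\<^sub>1 \<alpha> = S \<alpha>}"
    using assms unfolding diamond_def by (elim exE conjE)
  have "infinite (Field \<omega>\<^sub>1)" using uncountable_Field_omega1 countable_finite by blast
  then obtain e :: "nat \<Rightarrow> nat set" where e: "inj e" "range e \<subseteq> Field \<omega>\<^sub>1"
    using infinite_countable_subset by blast
  obtain \<gamma> where \<gamma>: "\<gamma> \<in> Field \<omega>\<^sub>1" "range e \<subseteq> underS \<omega>\<^sub>1 \<gamma>"
    using countable_bounded_omega1[of "range e"] e by auto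
  have "A \<in> (\<lambda>\<alpha>. e -` S \<alpha>) ` Field \<omega>\<^sub>1" for A :: "nat set"
  proof -
    have "e ` A \<subseteq> Field \<omega>\<^sub>1" using e by blast
    then have "stationary {\<alpha>\<in>Field \<omega>\<^sub>1. e ` A \<inter> underS \<omega>\<^sub>1 \<alpha> = S \<alpha>}" using S by simp
    then have "{\<alpha>\<in>Field \<omega>\<^sub>1. e ` A \<inter> underS \<omega>\<^sub>1 \<alpha> = S \<alpha>} \<inter>
        {\<alpha>\<in>Field \<omega>\<^sub>1. \<gamma> \<in> underS \<omega>\<^sub>1 \<alpha>} \<noteq> {}"
      using club_above[OF \<gamma>(1)] unfolding stationary_def by simp
    then obtain \<alpha> where \<alpha>: "\<alpha> \<in> Field \<omega>\<^sub>1" "e ` A \<inter> underS \<omega>\<^sub>1 \<alpha> = S \<alpha>" "\<gamma> \<in> underS \<omega>\<^sub>1 \<alpha>"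
      by auto
    have "range e \<subseteq> underS \<omega>\<^sub>1 \<alpha>"
      using \<gamma>(2) underS_omega1_mono[OF \<alpha>(3)] by blast
    then have "S \<alpha> = e ` A" using \<alpha>(2) by blast
    then have "A = e -` S \<alpha>" using e(1) by (simp add: inj_vimage_image_eq)
    then show ?thesis using \<alpha>(1) by blast
  qed
  then show ?thesis by blast
qed

text \<open>The strict order of \<open>\<omega>\<^sub>1\<close> is pulled back along the injection
  \<open>g\<close>, which sends \<open>x\<close> to a chosen preimage of \<open>\<iota> x\<close>
  under \<open>h\<close>.\<close>

lemma CH_wellorder:
  fixes \<iota> :: "'a \<Rightarrow> nat set"
  assumes "inj \<iota>" "h ` Field \<omega>\<^sub>1 = (UNIV :: nat set set)"
  obtains r :: "'a rel" where "wf r" "trans r" "total r" "\<And>x. countable {y. (y, x) \<in> r}"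
proof -
  define g where "g x = inv_into (Field \<omega>\<^sub>1) h (\<iota> x)" for x
  have g: "inj g" "\<And>x. g x \<in> Field \<omega>\<^sub>1"
  proof -
    have "h (g x) = \<iota> x" for x unfolding g_def using assms(2) by (intro f_inv_into_f) simp
    then show "inj g" using assms(1) by (metis injD injI)
    show "g x \<in> Field \<omega>\<^sub>1" for x unfolding g_def using assms(2) by (intro inv_into_into) simp
  qed
  show ?thesis
  proof (rule that)
    show "wf (inv_image (\<omega>\<^sub>1 - Id) g)" using wo_rel.WF[OF wo_rel_omega1] by (rule wf_inv_image)
    show "trans (inv_image (\<omega>\<^sub>1 - Id) g)" using trans_strict_omega1 by (rule trans_inv_image)
    show "total (inv_image (\<omega>\<^sub>1 - Id) g)"
      using wo_rel.TOTALS[OF wo_rel_omega1] g by (auto simp: total_on_def inj_eq)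
    show "countable {y. (y, x) \<in> inv_image (\<omega>\<^sub>1 - Id) g}" for x
    proof -
      have "g ` {y. (y, x) \<in> inv_image (\<omega>\<^sub>1 - Id) g} \<subseteq> underS \<omega>\<^sub>1 (g x)"
        by (auto simp: underS_def)
      then have "countable (g ` {y. (y, x) \<in> inv_image (\<omega>\<^sub>1 - Id) g})"
        using countable_underS_omega1 countable_subset by blast
      then show ?thesis
        using countable_image_inj_on inj_on_subset[OF g(1) subset_UNIV] by blast
    qed
  qed
qed

section \<open>Tukey maximality\<close>

text \<open>An element is determined by its clopen approximations at all precisions. These form a
  subset \<open>N a\<close> of a countable type, coded as a set of naturals.\<close>

lemma random_algebra_embeds_continuum: "\<exists>\<iota> :: random_algebra \<Rightarrow> nat set. inj \<iota>"
proof -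
  define c where "c t = abs_random_algebra (clopen_of t)" for t
  define N where "N a = {(k, t). rmeas (a - c t) < 1 / real (Suc k) \<and> rmeas (c t - a) < 1 / real (Suc k)}" for a
  have le: "a \<le> b" if eq: "N a = N b" for a b
  proof -
    have "rmeas (a - b) \<le> 2 / real (Suc k)" for k
    proof -
      obtain t where t: "(k, t) \<in> N a"
        using random_algebra_separable[of "1 / real (Suc k)" a] by (auto simp: N_def c_def)
      then have "(k, t) \<in> N b" using eq by simp
      then show ?thesis using t rmeas_diff_triangle[of a b "c t"] by (simp add: N_def)
    qed
    moreover have "(\<lambda>k. 2 / real (Suc k)) \<longlonglongrightarrow> 0"
      using LIMSEQ_Suc[OF lim_const_over_n] by simp
    ultimately have "rmeas (a - b) \<le> 0" by (intro LIMSEQ_le_const) auto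
    then have "rmeas (a - b) = 0" using rmeas_nonneg[of "a - b"] by linarith
    then show ?thesis by (simp add: diff_eq inf_shunt)
  qed
  have "inj (\<lambda>a. to_nat ` N a)"
  proof (rule injI)
    fix a b assume "to_nat ` N a = to_nat ` N b"
    then have "N a = N b" by (simp add: inj_image_eq_iff)
    then show "a = b" using le[of a b] le[of b a] by (intro order.antisym) simp_all
  qed
  then show ?thesis by blast
qed

text \<open>A sequence of sets of naturals is coded as one set by pairing; its section at
  \<open>n\<close> recovers the \<open>n\<close>-th set.\<close>

lemma inj_sequences_continuum:
  fixes \<iota> :: "'a \<Rightarrow> nat set"
  assumes "inj \<iota>"
  shows "inj (\<lambda>s. prod_encode ` (SIGMA n:UNIV. \<iota> (s n)))"
proof (rule injI)
  fix s t :: "nat \<Rightarrow> 'a"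
  assume "prod_encode ` (SIGMA n:UNIV. \<iota> (s n)) = prod_encode ` (SIGMA n:UNIV. \<iota> (t n))"
  then have eq: "(SIGMA n:UNIV. \<iota> (s n)) = (SIGMA n:UNIV. \<iota> (t n))"
    by (simp add: inj_image_eq_iff inj_prod_encode)
  have "\<iota> (s n) = \<iota> (t n)" for n
  proof -
    have "\<iota> (s n) = (SIGMA n:UNIV. \<iota> (s n)) `` {n}" by auto
    also have "\<dots> = \<iota> (t n)" unfolding eq by auto
    finally show ?thesis .
  qed
  then show "s = t" using assms by (auto simp: inj_eq)
qed

text \<open>Each value avoids the finitely many earlier ones. The value at \<open>0\<close> is
  prescribed because convergence is later measured from the term with index
  \<open>0\<close>.\<close>

lemma infinite_sets_injective_choice:
  fixes A :: "nat \<Rightarrow> 'a set"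
  assumes "\<And>n. infinite (A n)" "a \<in> A 0"
  obtains f where "inj f" "f 0 = a" "\<And>n. f n \<in> A n"
proof -
  have "\<exists>f. \<forall>n. f n \<in> A n - f ` {..<n} \<and> (n = 0 \<longrightarrow> f n = a)"
  proof (rule dependent_wf_choice[OF wf_less])
    fix f g :: "nat \<Rightarrow> 'a" and n x
    assume "\<And>m. (m, n) \<in> {(x, y). x < y} \<Longrightarrow> f m = g m"
    then have "f ` {..<n} = g ` {..<n}" by auto
    then show "(x \<in> A n - f ` {..<n} \<and> (n = 0 \<longrightarrow> x = a)) =
        (x \<in> A n - g ` {..<n} \<and> (n = 0 \<longrightarrow> x = a))" by simp
  next
    fix n and f :: "nat \<Rightarrow> 'a"
    have "infinite (A n - f ` {..<n})" using assms(1) by simp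
    then obtain x where x: "x \<in> A n - f ` {..<n}" using infinite_imp_nonempty by blast
    show "\<exists>x. x \<in> A n - f ` {..<n} \<and> (n = 0 \<longrightarrow> x = a)"
    proof (cases "n = 0")
      case True
      then show ?thesis using assms(2) by auto
    next
      case False
      then show ?thesis using x by auto
    qed
  qed
  then obtain f where f: "\<And>n. f n \<in> A n" "\<And>n. f n \<notin> f ` {..<n}" "f 0 = a" by blast
  have "f m \<noteq> f n" if "m < n" for m n
    using f(2)[of n] that by (metis imageI lessThan_iff)
  then have "inj f" by (metis injI linorder_neqE_nat)
  then show ?thesis using that f by blast
qed

text \<open>For a Tukey map, an element of \<open>U\<close> can lie below the images of only
  finitely many singletons. The hypothesis contradicts this along an injective sequence of
  singletons whose images converge.\<close>

lemma not_tukey_maximal_random_algebra: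
  fixes U :: "random_algebra set"
  assumes seq: "\<And>s. range s \<subseteq> U \<Longrightarrow> (\<lambda>n. rmeas (s 0 - s n)) \<longlonglongrightarrow> 0 \<Longrightarrow>
    \<exists>w\<in>U. infinite {n. w \<le> s n}"
  shows "\<not> tukey_maximal U"
proof
  assume "tukey_maximal U"
  then obtain f and g :: "random_algebra \<Rightarrow> random_algebra set"
    where f: "\<forall>F. finite F \<longrightarrow> f F \<in> U" and g: "\<forall>e\<in>U. finite (g e)"
      and fg: "\<forall>F. finite F \<longrightarrow> (\<forall>e\<in>U. e \<le> f F \<longrightarrow> F \<subseteq> g e)"
    unfolding tukey_maximal_def tukey_le_def by (auto simp: Pi_iff)
  define h where "h b = f {b}" for b
  have hU: "h b \<in> U" for b using f by (simp add: h_def)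
  have fin: "finite {b. e \<le> h b}" if "e \<in> U" for e
  proof (rule finite_subset)
    show "{b. e \<le> h b} \<subseteq> g e"
    proof
      fix b assume "b \<in> {b. e \<le> h b}"
      then have "{b} \<subseteq> g e" using fg[rule_format, of "{b}" e] that by (simp add: h_def)
      then show "b \<in> g e" by simp
    qed
  qed (use g that in simp)
  \<comment> \<open>The fibre of \<open>h\<close> over \<open>e\<close> lies in
    \<open>{b. e \<le> h b}\<close>, so \<open>h\<close> is finite-to-one on an uncountable
    algebra.\<close>
  have "uncountable (range h)"
  proof
    assume "countable (range h)"
    moreover have "countable {b. e \<le> h b}" if "e \<in> range h" for e
      using fin that hU by (intro countable_finite) auto
    ultimately have "countable (\<Union>e\<in>range h. {b. e \<le> h b})" by (rule countable_UN)
    moreover have "(\<Union>e\<in>range h. {b. e \<le> h b}) = UNIV" by auto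
    ultimately show False using uncountable_random_algebra by simp
  qed
  then obtain c where c: "\<And>\<epsilon>. \<epsilon> > 0 \<Longrightarrow> infinite {y\<in>range h. rmeas (h c - y) < \<epsilon>}"
    using uncountable_has_accumulation_point by blast
  \<comment> \<open>Arguments of \<open>h\<close> are selected rather than values: the contradiction
    counts the arguments \<open>b\<close> with \<open>w \<le> h b\<close>, and \<open>h\<close> may
    identify some of them.\<close>
  define A where "A n = {b. rmeas (h c - h b) < 1 / real (Suc n)}" for n
  have A: "infinite (A n)" for n
  proof
    assume "finite (A n)"
    then have "finite (h ` A n)" by simp
    moreover have "{y\<in>range h. rmeas (h c - y) < 1 / real (Suc n)} \<subseteq> h ` A n"
      by (auto simp: A_def)
    ultimately show False using c[of "1 / real (Suc n)"] finite_subset by auto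
  qed
  have c0: "c \<in> A 0" by (simp add: A_def diff_eq)
  obtain \<beta> where \<beta>: "inj \<beta>" "\<beta> 0 = c" "\<And>n. \<beta> n \<in> A n"
    by (rule infinite_sets_injective_choice[of A, OF A c0]) (rule that)
  have "(\<lambda>n. rmeas (h (\<beta> 0) - h (\<beta> n))) \<longlonglongrightarrow> 0"
  proof (rule tendsto_sandwich[OF always_eventually always_eventually tendsto_const])
    show "\<forall>n. rmeas (h (\<beta> 0) - h (\<beta> n)) \<le> 1 / real (Suc n)"
      using \<beta>(3) by (auto simp: A_def \<beta>(2) intro: less_imp_le)
    show "(\<lambda>n. 1 / real (Suc n)) \<longlonglongrightarrow> 0"
      using LIMSEQ_Suc[OF lim_const_over_n] by simp
  qed simp
  then obtain w where w: "w \<in> U" "infinite {n. w \<le> h (\<beta> n)}"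
    using seq[of "\<lambda>n. h (\<beta> n)"] hU by auto
  have "\<beta> ` {n. w \<le> h (\<beta> n)} \<subseteq> {b. w \<le> h b}" by auto
  then have "finite (\<beta> ` {n. w \<le> h (\<beta> n)})" using fin[OF w(1)] finite_subset by blast
  then show False using w(2) \<beta>(1) finite_imageD inj_on_subset subset_UNIV by blast
qed

theorem theorem5p2:
  assumes "\<diamond>"
  shows "\<exists>U :: random_algebra set. ultrafilter U \<and> \<not> tukey_maximal U"
proof -
  obtain h where h: "h ` Field \<omega>\<^sub>1 = (UNIV :: nat set set)" using diamond_imp_CH[OF assms] ..
  obtain \<iota> :: "random_algebra \<Rightarrow> nat set" where "inj \<iota>"
    using random_algebra_embeds_continuum ..
  \<comment> \<open>CH is applied to sequences of elements, which embed into the sets of naturals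
    just as single elements do.\<close>
  then obtain r :: "(nat \<Rightarrow> random_algebra) rel"
    where r: "wf r" "trans r" "total r" "\<And>s. countable {t. (t, s) \<in> r}"
    by (rule CH_wellorder[OF inj_sequences_continuum h]) (rule that)
  obtain U where "ultrafilter U"
    "\<And>s. range s \<subseteq> U \<Longrightarrow> (\<lambda>n. rmeas (s 0 - s n)) \<longlonglongrightarrow> 0 \<Longrightarrow> \<exists>w\<in>U. infinite {n. w \<le> s n}"
    by (rule settling_ultrafilter[OF r]) (rule that)
  then show ?thesis using not_tukey_maximal_random_algebra by blast
qed

end
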